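(* Fix $t\in[0,\infty]$. Define $\mathcal{R}_t$ on out-ordered digraphs by $\mathcal{R}_t(S,\Gamma,\preceq)=(S,\sim_t)$, where $x\sim_t y$ if and only if $x=y$ or $x$ and $y$ are joined by a path in the graph $(S,\mathcal{L}_t)$. Define $\mathcal{R}_t$ on neighborhood-ordinal injections by $\mathcal{R}_t(\iota)=\iota$. Then $\mathcal{R}_t$ (rank-based linkage with cut-off $t$) is a functor from the category of out-ordered digraphs with neighborhood-ordinal injections to the category of partitioned sets. In particular, for every neighborhood-ordinal injection $\iota:(S,\Gamma,\preceq)\to(S',\Gamma',\preceq')$ and all $x,y\in S$, if $x\sim_t y$ in $\mathcal{R}_t(S,\Gamma,\preceq)$ then $\iota(x)\sim_t\iota(y)$ in $\mathcal{R}_t(S',\Gamma',\preceq')$.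
   Context: Out-ordered digraphs. An out-ordered digraph is $(S,\Gamma,\preceq)$ where: - $S$ is a set; - $\Gamma:S\to\mathcal{P}(S)$ is a function; - $\preceq_x$ is a partial order on $\Gamma(x)$ for each $x$. We write $\prec_x$ for its strict part. Neighborhood-ordinal injections. A neighborhood-ordinal injection $\iota:(S,\Gamma,\preceq)\to(S',\Gamma',\preceq')$ is an injective map $\iota:S\to S'$ such that: - $y\in\Gamma(x)$ implies $\iota(y)\in\Gamma'(\iota(x))$; - $y\preceq_x z$ implies $\iota(y)\preceq'_{\iota(x)}\iota(z)$; - for all $x$ and $w\in\Gamma'(\iota(x))\setminus\iota(\Gamma(x))$, we have $\iota(y)\prec'_{\iota(x)}w$ for all $y\in\Gamma(x)$. Mutual friends. $x,z$ are mutual friends if $z\in\Gamma(x)$ and $x\in\Gamma(z)$. Third-wheels. $$\mathscr{F}(x,z)=\{y: x,z\in\Gamma(y)\}\cup\{y: y\in\Gamma(x),z\in\Gamma(y)\}\cup\{y: x\in\Gamma(y),y\in\Gamma(z)\}.$$ In-sway. For mutual friends $x,z$, the in-sway is $\sigma(\{x,z\})=\operatorname{card}\{y\in\mathscr{F}(x,z): (y\in\Gamma(x)\Rightarrow z\prec_x y)\text{ and }(y\in\Gamma(z)\Rightarrow x\prec_z y)\}$. Cut-off graph. $\mathcal{L}_t$ is the set of pairs $\{x,z\}$ of mutual friends with $\sigma(\{x,z\})\ge t$. Partitioned sets. A partitioned set is a set with an equivalence relation. Morphisms of partitioned sets are functions preserving the relation. *)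

theory Defs
  imports "HOL-Library.FuncSet" "HOL-Library.Extended_Nonnegative_Real"
begin

text \<open>
  Categories are presented by hom-sets indexed by pairs of objects; these sets need not be
  disjoint. \<open>Comp \<C> A B C g f\<close> is the composite of \<open>f : A \<rightarrow> B\<close> and \<open>g : B \<rightarrow> C\<close>.
\<close>

record ('o, 'm) cat_data =
  Obj :: "'o set"
  Hom :: "'o \<Rightarrow> 'o \<Rightarrow> 'm set"
  Ident :: "'o \<Rightarrow> 'm"
  Comp :: "'o \<Rightarrow> 'o \<Rightarrow> 'o \<Rightarrow> 'm \<Rightarrow> 'm \<Rightarrow> 'm"

locale category =
  fixes \<C> :: "('o, 'm) cat_data"
  assumes ident_hom: "A \<in> Obj \<C> \<Longrightarrow> Ident \<C> A \<in> Hom \<C> A A"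
    and comp_hom: "\<lbrakk>A \<in> Obj \<C>; B \<in> Obj \<C>; C \<in> Obj \<C>; f \<in> Hom \<C> A B; g \<in> Hom \<C> B C\<rbrakk>
      \<Longrightarrow> Comp \<C> A B C g f \<in> Hom \<C> A C"
    and comp_ident_right: "\<lbrakk>A \<in> Obj \<C>; B \<in> Obj \<C>; f \<in> Hom \<C> A B\<rbrakk>
      \<Longrightarrow> Comp \<C> A A B f (Ident \<C> A) = f"
    and comp_ident_left: "\<lbrakk>A \<in> Obj \<C>; B \<in> Obj \<C>; f \<in> Hom \<C> A B\<rbrakk>
      \<Longrightarrow> Comp \<C> A B B (Ident \<C> B) f = f"
    and comp_assoc: "\<lbrakk>A \<in> Obj \<C>; B \<in> Obj \<C>; C \<in> Obj \<C>; D \<in> Obj \<C>;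
        f \<in> Hom \<C> A B; g \<in> Hom \<C> B C; h \<in> Hom \<C> C D\<rbrakk>
      \<Longrightarrow> Comp \<C> A C D h (Comp \<C> A B C g f) = Comp \<C> A B D (Comp \<C> B C D h g) f"

locale cat_functor = source: category \<C> + target: category \<D>
  for \<C> :: "('o, 'm) cat_data" and \<D> :: "('p, 'n) cat_data" +
  fixes F_obj :: "'o \<Rightarrow> 'p"
    and F_mor :: "'o \<Rightarrow> 'o \<Rightarrow> 'm \<Rightarrow> 'n"
  assumes map_obj: "A \<in> Obj \<C> \<Longrightarrow> F_obj A \<in> Obj \<D>"
    and map_hom: "\<lbrakk>A \<in> Obj \<C>; B \<in> Obj \<C>; f \<in> Hom \<C> A B\<rbrakk>
      \<Longrightarrow> F_mor A B f \<in> Hom \<D> (F_obj A) (F_obj B)"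
    and map_ident: "A \<in> Obj \<C> \<Longrightarrow> F_mor A A (Ident \<C> A) = Ident \<D> (F_obj A)"
    and map_comp: "\<lbrakk>A \<in> Obj \<C>; B \<in> Obj \<C>; C \<in> Obj \<C>; f \<in> Hom \<C> A B; g \<in> Hom \<C> B C\<rbrakk>
      \<Longrightarrow> F_mor A C (Comp \<C> A B C g f)
        = Comp \<D> (F_obj A) (F_obj B) (F_obj C) (F_mor B C g) (F_mor A B f)"

text \<open>
  In \<open>G\<close>, the set is \<open>verts G\<close>, the map \<open>\<Gamma>\<close> is \<open>nbrs G\<close>, and \<open>(y, z) \<in> pref G x\<close> means
  \<open>y \<preceq>\<^sub>x z\<close>. Values of \<open>nbrs G\<close> and \<open>pref G\<close> outside \<open>verts G\<close> are irrelevant.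
\<close>

record 'a out_digraph =
  verts :: "'a set"
  nbrs :: "'a \<Rightarrow> 'a set"
  pref :: "'a \<Rightarrow> 'a rel"

definition out_ordered_digraph :: "'a out_digraph \<Rightarrow> bool" where
  "out_ordered_digraph G \<longleftrightarrow>
     nbrs G \<in> verts G \<rightarrow> Pow (verts G) \<and>
     (\<forall>x\<in>verts G. partial_order_on (nbrs G x) (pref G x))"

definition strict_pref :: "'a out_digraph \<Rightarrow> 'a \<Rightarrow> 'a rel" where
  "strict_pref G x = {(y, z) \<in> pref G x. y \<noteq> z}"

definition nbhd_ordinal_injection :: "'a out_digraph \<Rightarrow> 'b out_digraph \<Rightarrow> ('a \<Rightarrow> 'b) \<Rightarrow> bool" where
  "nbhd_ordinal_injection G H \<iota> \<longleftrightarrow>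
     \<iota> \<in> verts G \<rightarrow> verts H \<and> inj_on \<iota> (verts G) \<and>
     (\<forall>x\<in>verts G. \<forall>y\<in>nbrs G x. \<iota> y \<in> nbrs H (\<iota> x)) \<and>
     (\<forall>x\<in>verts G. \<forall>y z. (y, z) \<in> pref G x \<longrightarrow> (\<iota> y, \<iota> z) \<in> pref H (\<iota> x)) \<and>
     (\<forall>x\<in>verts G. \<forall>w \<in> nbrs H (\<iota> x) - \<iota> ` nbrs G x. \<forall>y\<in>nbrs G x.
        (\<iota> y, w) \<in> strict_pref H (\<iota> x))"

text \<open>
  Extensionality makes equality of objects and of morphisms agree with equality of the
  underlying set-theoretic data. The objects are those with carrier inside the arbitrary
  type \<open>'a\<close>, which plays the role of the universe.
\<close>

definition out_digraph_cat :: "('a out_digraph, 'a \<Rightarrow> 'a) cat_data" where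
  "out_digraph_cat = \<lparr>
     Obj = {G. out_ordered_digraph G \<and>
       nbrs G \<in> extensional (verts G) \<and> pref G \<in> extensional (verts G)},
     Hom = (\<lambda>G H. {\<iota> \<in> extensional (verts G). nbhd_ordinal_injection G H \<iota>}),
     Ident = (\<lambda>G. \<lambda>x\<in>verts G. x),
     Comp = (\<lambda>G H K g f. compose (verts G) g f)\<rparr>"

type_synonym 'a partitioned_set = "'a set \<times> 'a rel"

definition partitioned_set_cat :: "('a partitioned_set, 'a \<Rightarrow> 'a) cat_data" where
  "partitioned_set_cat = \<lparr>
     Obj = {(S, r). equiv S r},
     Hom = (\<lambda>(S, r) (S', r'). {f \<in> S \<rightarrow>\<^sub>E S'. \<forall>(x, y)\<in>r. (f x, f y) \<in> r'}),
     Ident = (\<lambda>(S, r). \<lambda>x\<in>S. x),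
     Comp = (\<lambda>(S, r) Q R g f. compose S g f)\<rparr>"

definition mutual_friends :: "'a out_digraph \<Rightarrow> 'a \<Rightarrow> 'a \<Rightarrow> bool" where
  "mutual_friends G x z \<longleftrightarrow>
     x \<in> verts G \<and> z \<in> verts G \<and> z \<in> nbrs G x \<and> x \<in> nbrs G z"

definition third_wheels :: "'a out_digraph \<Rightarrow> 'a \<Rightarrow> 'a \<Rightarrow> 'a set" where
  "third_wheels G x z =
     {y \<in> verts G. x \<in> nbrs G y \<and> z \<in> nbrs G y} \<union>
     {y \<in> verts G. y \<in> nbrs G x \<and> z \<in> nbrs G y} \<union>
     {y \<in> verts G. x \<in> nbrs G y \<and> y \<in> nbrs G z}"

definition ext_card :: "'a set \<Rightarrow> ennreal" where
  "ext_card A = (if finite A then of_nat (card A) else \<infinity>)"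

definition in_sway :: "'a out_digraph \<Rightarrow> 'a \<Rightarrow> 'a \<Rightarrow> ennreal" where
  "in_sway G x z = ext_card {y \<in> third_wheels G x z.
     (y \<in> nbrs G x \<longrightarrow> (z, y) \<in> strict_pref G x) \<and>
     (y \<in> nbrs G z \<longrightarrow> (x, y) \<in> strict_pref G z)}"

text \<open>So \<open>in_sway\<close> is a function of the unordered pair.\<close>

lemma in_sway_commute: "in_sway G x z = in_sway G z x"
proof -
  have "third_wheels G x z = third_wheels G z x"
    by (auto simp: third_wheels_def)
  then show ?thesis
    by (simp add: in_sway_def conj_commute)
qed

definition cutoff_edges :: "ennreal \<Rightarrow> 'a out_digraph \<Rightarrow> 'a set set" where
  "cutoff_edges t G = {{x, z} | x z. mutual_friends G x z \<and> t \<le> in_sway G x z}"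

definition is_path :: "'a set \<Rightarrow> 'a set set \<Rightarrow> 'a \<Rightarrow> 'a list \<Rightarrow> 'a \<Rightarrow> bool" where
  "is_path V E x p y \<longleftrightarrow>
     p \<noteq> [] \<and> hd p = x \<and> last p = y \<and> set p \<subseteq> V \<and> distinct p \<and>
     successively (\<lambda>u v. {u, v} \<in> E) p"

definition linkage_rel :: "ennreal \<Rightarrow> 'a out_digraph \<Rightarrow> 'a rel" where
  "linkage_rel t G = {(x, y) \<in> verts G \<times> verts G.
     x = y \<or> (\<exists>p. is_path (verts G) (cutoff_edges t G) x p y)}"

definition rank_linkage :: "ennreal \<Rightarrow> 'a out_digraph \<Rightarrow> 'a partitioned_set" where
  "rank_linkage t G = (verts G, linkage_rel t G)"

end

theory Submission
  imports Defs
begin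

text \<open>
  An injection \<open>\<iota>\<close> maps the vertices counted by \<open>\<sigma>({x, z})\<close> into those counted by
  \<open>\<sigma>({\<iota> x, \<iota> z})\<close>: a third wheel \<open>y\<close> with \<open>y \<in> \<Gamma>(x)\<close> remains ranked after \<open>z\<close> because \<open>\<iota>\<close> is
  monotone and injective, and if \<open>y \<notin> \<Gamma>(x)\<close> but \<open>\<iota> y \<in> \<Gamma>'(\<iota> x)\<close> then \<open>\<iota> y\<close> is a new neighbour,
  hence ranked after \<open>\<iota> z\<close>. So in-sways do not decrease, and \<open>\<iota>\<close> maps edges of the cut-off
  graph to edges, hence paths to paths.
\<close>

section \<open>Neighborhoods, preferences and extended cardinality\<close>

lemma pref_subset_nbrs:
  assumes "out_ordered_digraph G" "x \<in> verts G" "(y, z) \<in> pref G x"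
  shows "y \<in> nbrs G x" "z \<in> nbrs G x"
  using assms by (auto simp: out_ordered_digraph_def order_on_defs refl_on_def)

lemma nbrs_subset_verts:
  assumes "out_ordered_digraph G" "x \<in> verts G" "y \<in> nbrs G x"
  shows "y \<in> verts G"
  using assms by (auto simp: out_ordered_digraph_def)

lemma ext_card_inj_on_le:
  assumes "inj_on f A" "f ` A \<subseteq> B"
  shows "ext_card A \<le> ext_card B"
proof (cases "finite B")
  case True
  then show ?thesis
    using assms card_inj_on_le[OF assms True] inj_on_finite[OF assms True]
    by (simp add: ext_card_def)
qed (simp add: ext_card_def)

section \<open>Effect of a neighborhood-ordinal injection on the cut-off graph\<close>

context
  fixes G :: "'a out_digraph" and H :: "'b out_digraph" and \<iota> :: "'a \<Rightarrow> 'b"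
  assumes inj: "nbhd_ordinal_injection G H \<iota>"
begin

lemma injection_in_verts: "x \<in> verts G \<Longrightarrow> \<iota> x \<in> verts H"
  using inj by (auto simp: nbhd_ordinal_injection_def)

lemma injection_inj_on: "inj_on \<iota> (verts G)"
  using inj by (auto simp: nbhd_ordinal_injection_def)

lemma injection_in_nbrs: "x \<in> verts G \<Longrightarrow> y \<in> nbrs G x \<Longrightarrow> \<iota> y \<in> nbrs H (\<iota> x)"
  using inj by (auto simp: nbhd_ordinal_injection_def)

lemma injection_pref: "x \<in> verts G \<Longrightarrow> (y, z) \<in> pref G x \<Longrightarrow> (\<iota> y, \<iota> z) \<in> pref H (\<iota> x)"
  using inj by (auto simp: nbhd_ordinal_injection_def)

lemma injection_new_nbr:
  "x \<in> verts G \<Longrightarrow> w \<in> nbrs H (\<iota> x) \<Longrightarrow> w \<notin> \<iota> ` nbrs G x \<Longrightarrow> y \<in> nbrs G x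
    \<Longrightarrow> (\<iota> y, w) \<in> strict_pref H (\<iota> x)"
  using inj by (auto simp: nbhd_ordinal_injection_def)

lemma mutual_friends_injection: "mutual_friends G x z \<Longrightarrow> mutual_friends H (\<iota> x) (\<iota> z)"
  by (auto simp: mutual_friends_def injection_in_verts injection_in_nbrs)

lemma third_wheels_injection:
  assumes "x \<in> verts G" "z \<in> verts G" "y \<in> third_wheels G x z"
  shows "\<iota> y \<in> third_wheels H (\<iota> x) (\<iota> z)"
  using assms by (auto simp: third_wheels_def injection_in_verts injection_in_nbrs)

context
  assumes G: "out_ordered_digraph G"
begin

text \<open>Monotonicity yields only the weak relation. Strictness comes from injectivity, which
  applies because \<open>y\<close> and \<open>z\<close> are neighbours of \<open>x\<close> and hence
  vertices.\<close>

lemma injection_strict_pref: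
  assumes "x \<in> verts G" "(y, z) \<in> strict_pref G x"
  shows "(\<iota> y, \<iota> z) \<in> strict_pref H (\<iota> x)"
proof -
  have yz: "(y, z) \<in> pref G x" "y \<noteq> z"
    using assms by (auto simp: strict_pref_def)
  then have "y \<in> verts G" "z \<in> verts G"
    using assms pref_subset_nbrs nbrs_subset_verts G by metis+
  then show ?thesis
    using yz assms injection_pref inj_onD[OF injection_inj_on]
    by (auto simp: strict_pref_def)
qed

lemma injection_ranks_after:
  assumes "x \<in> verts G" "y \<in> verts G" "z \<in> nbrs G x"
    and "y \<in> nbrs G x \<Longrightarrow> (z, y) \<in> strict_pref G x" and "\<iota> y \<in> nbrs H (\<iota> x)"
  shows "(\<iota> z, \<iota> y) \<in> strict_pref H (\<iota> x)"
proof (cases "y \<in> nbrs G x")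
  case True
  then show ?thesis
    using assms injection_strict_pref by blast
next
  case False
  \<comment> \<open>If \<open>\<iota> y\<close> were the image of a neighbour of \<open>x\<close>,
    injectivity on vertices would make \<open>y\<close> that neighbour.\<close>
  then have "\<iota> y \<notin> \<iota> ` nbrs G x"
    using assms(1,2) nbrs_subset_verts[OF G] inj_onD[OF injection_inj_on] by blast
  then show ?thesis
    using assms injection_new_nbr by blast
qed

lemma in_sway_injection_le:
  assumes "mutual_friends G x z"
  shows "in_sway G x z \<le> in_sway H (\<iota> x) (\<iota> z)"
  unfolding in_sway_def
proof (rule ext_card_inj_on_le)
  let ?A = "{y \<in> third_wheels G x z.
     (y \<in> nbrs G x \<longrightarrow> (z, y) \<in> strict_pref G x) \<and> (y \<in> nbrs G z \<longrightarrow> (x, y) \<in> strict_pref G z)}"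
  have A: "?A \<subseteq> verts G"
    by (auto simp: third_wheels_def)
  then show "inj_on \<iota> ?A"
    by (rule inj_on_subset[OF injection_inj_on])
  show "\<iota> ` ?A \<subseteq> {y \<in> third_wheels H (\<iota> x) (\<iota> z).
     (y \<in> nbrs H (\<iota> x) \<longrightarrow> (\<iota> z, y) \<in> strict_pref H (\<iota> x)) \<and>
     (y \<in> nbrs H (\<iota> z) \<longrightarrow> (\<iota> x, y) \<in> strict_pref H (\<iota> z))}"
  proof (intro image_subsetI CollectI conjI impI)
    fix y
    assume y: "y \<in> ?A"
    have xz: "x \<in> verts G" "z \<in> verts G" "z \<in> nbrs G x" "x \<in> nbrs G z"
      using assms by (auto simp: mutual_friends_def)
    show "\<iota> y \<in> third_wheels H (\<iota> x) (\<iota> z)"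
      using y xz third_wheels_injection by blast
    show "(\<iota> z, \<iota> y) \<in> strict_pref H (\<iota> x)" if "\<iota> y \<in> nbrs H (\<iota> x)"
      using y xz A that by (intro injection_ranks_after) auto
    show "(\<iota> x, \<iota> y) \<in> strict_pref H (\<iota> z)" if "\<iota> y \<in> nbrs H (\<iota> z)"
      using y xz A that by (intro injection_ranks_after) auto
  qed
qed

lemma cutoff_edges_injection:
  assumes "{x, z} \<in> cutoff_edges t G"
  shows "{\<iota> x, \<iota> z} \<in> cutoff_edges t H"
proof -
  \<comment> \<open>The unordered edge determines \<open>u\<close>, \<open>v\<close> only up to
    exchange with \<open>x\<close>, \<open>z\<close>, so the argument runs on \<open>u\<close>,
    \<open>v\<close> and compares images of sets.\<close>
  obtain u v where uv: "{x, z} = {u, v}" "mutual_friends G u v" "t \<le> in_sway G u v"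
    using assms by (auto simp: cutoff_edges_def)
  have "{\<iota> x, \<iota> z} = {\<iota> u, \<iota> v}"
    using uv(1) by (metis image_empty image_insert)
  then show ?thesis
    using uv mutual_friends_injection order_trans[OF uv(3) in_sway_injection_le]
    unfolding cutoff_edges_def by blast
qed

text \<open>The image of a path under \<iota> is again a path: consecutive edges are preserved, and
  injectivity keeps the vertices distinct.\<close>

lemma linkage_rel_injection:
  assumes "(x, y) \<in> linkage_rel t G"
  shows "(\<iota> x, \<iota> y) \<in> linkage_rel t H"
proof -
  have path: "is_path (verts H) (cutoff_edges t H) (\<iota> x) (map \<iota> p) (\<iota> y)"
    if p: "is_path (verts G) (cutoff_edges t G) x p y" for p
  proof -
    have "successively (\<lambda>u v. {\<iota> u, \<iota> v} \<in> cutoff_edges t H) p"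
      using p by (auto simp: is_path_def cutoff_edges_injection intro: successively_mono)
    moreover have "inj_on \<iota> (set p)"
      using p inj_on_subset[OF injection_inj_on] by (auto simp: is_path_def)
    ultimately show ?thesis
      using p injection_in_verts
      by (auto simp: is_path_def hd_map last_map distinct_map successively_map)
  qed
  then show ?thesis
    using assms injection_in_verts by (auto simp: linkage_rel_def)
qed

end

end

section \<open>Linkage as an equivalence relation\<close>

text \<open>Vertices of a path are distinct, so \<open>z\<close> can be appended only if it is new;
  otherwise \<open>p\<close> is cut off at its occurrence of \<open>z\<close>.\<close>

lemma is_path_snoc:
  assumes "is_path V E x p y" "{y, z} \<in> E" "z \<in> V"
  shows "\<exists>q. is_path V E x q z"
proof (cases "z \<in> set p")
  case True
  then obtain a b where "p = a @ z # b"
    by (meson split_list)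
  then have "is_path V E x (a @ [z]) z"
    \<comment> \<open>If \<open>a\<close> is empty, then \<open>x = z\<close> and the path is the
      single vertex \<open>z\<close>.\<close>
    using assms by (cases a) (auto simp: is_path_def hd_append successively_append_iff successively_Cons)
  then show ?thesis ..
next
  case False
  then have "is_path V E x (p @ [z]) z"
    using assms by (auto simp: is_path_def successively_append_iff)
  then show ?thesis ..
qed

text \<open>Plain concatenation could repeat vertices. Instead the vertices of \<open>q\<close> are
  added one by one with \<open>is_path_snoc\<close>; since this changes the first path and its
  endpoint, the induction generalizes over both.\<close>

lemma is_path_trans:
  assumes "is_path V E x p y" "is_path V E y q z"
  shows "\<exists>r. is_path V E x r z"
  using assms
proof (induction q arbitrary: y p)
  case Nil
  then show ?case by (simp add: is_path_def)
next
  case (Cons a q)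
  show ?case
  proof (cases q)
    case Nil
    then show ?thesis
      using Cons.prems by (auto simp: is_path_def)
  next
    case (Cons b q')
    then have "{y, b} \<in> E" "b \<in> V" and q: "is_path V E b q z"
      using Cons.prems(2) by (auto simp: is_path_def)
    then obtain p' where "is_path V E x p' b"
      using is_path_snoc Cons.prems(1) by metis
    then show ?thesis
      using Cons.IH q by blast
  qed
qed

lemma is_path_rev: "is_path V E x p y \<Longrightarrow> is_path V E y (rev p) x"
  by (auto simp: is_path_def hd_rev last_rev insert_commute)

lemma equiv_linkage_rel: "equiv (verts G) (linkage_rel t G)"
proof (rule equivI)
  show "linkage_rel t G \<subseteq> verts G \<times> verts G"
    by (auto simp: linkage_rel_def)
  show "refl_on (verts G) (linkage_rel t G)"
    by (auto simp: refl_on_def linkage_rel_def)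
  show "sym (linkage_rel t G)"
    using is_path_rev by (fastforce simp: sym_def linkage_rel_def)
  show "trans (linkage_rel t G)"
    using is_path_trans by (fastforce simp: trans_def linkage_rel_def)
qed

section \<open>Identities and composites of neighborhood-ordinal injections\<close>

lemma nbhd_ordinal_injection_ident:
  assumes "out_ordered_digraph G"
  shows "nbhd_ordinal_injection G G (\<lambda>x\<in>verts G. x)"
proof -
  \<comment> \<open>Hence there are no new neighbours, and the condition on them is vacuous.\<close>
  have "(\<lambda>x\<in>verts G. x) ` nbrs G x = nbrs G x" if "x \<in> verts G" for x
    using nbrs_subset_verts[OF assms that] by force
  then show ?thesis
    using pref_subset_nbrs[OF assms] nbrs_subset_verts[OF assms]
    by (auto simp: nbhd_ordinal_injection_def inj_on_def)
qed

text \<open>All conditions evaluate the map at vertices only, since neighbours and ranked elements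
  are vertices. This lets the restricted \<open>compose\<close> replace the plain composite.\<close>

lemma nbhd_ordinal_injection_cong:
  assumes "out_ordered_digraph G" "\<And>x. x \<in> verts G \<Longrightarrow> f x = g x"
  shows "nbhd_ordinal_injection G H f \<longleftrightarrow> nbhd_ordinal_injection G H g"
proof -
  have "f y = g y" if "x \<in> verts G" "y \<in> nbrs G x" for x y
    using that assms nbrs_subset_verts by metis
  moreover from this have "f ` nbrs G x = g ` nbrs G x" if "x \<in> verts G" for x
    using that by (intro image_cong) auto
  moreover have "f y = g y" "f z = g z" if "x \<in> verts G" "(y, z) \<in> pref G x" for x y z
    using that assms nbrs_subset_verts pref_subset_nbrs by metis+
  moreover have "f \<in> verts G \<rightarrow> verts H \<longleftrightarrow> g \<in> verts G \<rightarrow> verts H"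
    using assms(2) by (auto simp: Pi_iff)
  moreover have "inj_on f (verts G) \<longleftrightarrow> inj_on g (verts G)"
    using assms(2) by (rule inj_on_cong)
  ultimately show ?thesis
    unfolding nbhd_ordinal_injection_def using assms(2)
    by (smt (verit, best))
qed

text \<open>The point is the condition on new neighbours: a \<open>w\<close> that is new for the
  composite is either new for \<open>g\<close>, or the image under \<open>g\<close> of a
  \<open>v\<close> that is new for \<open>f\<close>; in the latter case \<open>g\<close> preserves
  the strict preference for \<open>v\<close>.\<close>

lemma nbhd_ordinal_injection_comp:
  assumes G: "out_ordered_digraph G" and H: "out_ordered_digraph H"
    and f: "nbhd_ordinal_injection G H f" and g: "nbhd_ordinal_injection H K g"
  shows "nbhd_ordinal_injection G K (g \<circ> f)"
proof -
  have "(g (f y), w) \<in> strict_pref K (g (f x))"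
    if x: "x \<in> verts G" and y: "y \<in> nbrs G x" and w: "w \<in> nbrs K (g (f x))"
      and new: "w \<notin> g ` f ` nbrs G x" for x y w
  proof (cases "w \<in> g ` nbrs H (f x)")
    case True
    then obtain v where v: "w = g v" "v \<in> nbrs H (f x)" by blast
    then have "(f y, v) \<in> strict_pref H (f x)"
      using injection_new_nbr[OF f x] y new by blast
    then show ?thesis
      using injection_strict_pref[OF g H] injection_in_verts[OF f x] v by blast
  next
    case False
    then show ?thesis
      using injection_new_nbr[OF g] injection_in_verts[OF f x] injection_in_nbrs[OF f x y] w
      by blast
  qed
  moreover have "inj_on (g \<circ> f) (verts G)"
    using injection_inj_on[OF f] injection_inj_on[OF g] injection_in_verts[OF f]
    by (auto intro!: comp_inj_on intro: inj_on_subset)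
  ultimately show ?thesis
    using injection_in_verts[OF f] injection_in_verts[OF g] injection_in_nbrs[OF f]
      injection_in_nbrs[OF g] injection_pref[OF f] injection_pref[OF g]
    by (simp add: nbhd_ordinal_injection_def image_comp)
qed

section \<open>The two categories and the functor\<close>

lemma category_out_digraph_cat: "category (out_digraph_cat :: ('u out_digraph, 'u \<Rightarrow> 'u) cat_data)"
proof
  fix A B C D :: "'u out_digraph" and f g h :: "'u \<Rightarrow> 'u"
  assume A: "A \<in> Obj out_digraph_cat"
  then have A': "out_ordered_digraph A"
    by (simp add: out_digraph_cat_def)
  show "Ident out_digraph_cat A \<in> Hom out_digraph_cat A A"
    using nbhd_ordinal_injection_ident[OF A'] by (simp add: out_digraph_cat_def)
  assume B: "B \<in> Obj out_digraph_cat" and f: "f \<in> Hom out_digraph_cat A B"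
  then have B': "out_ordered_digraph B"
    and f': "f \<in> extensional (verts A)" "f \<in> verts A \<rightarrow> verts B" "nbhd_ordinal_injection A B f"
    by (auto simp: out_digraph_cat_def nbhd_ordinal_injection_def)
  \<comment> \<open>Off the vertices both sides are \<open>undefined\<close>, by extensionality of
    \<open>f\<close>.\<close>
  show "Comp out_digraph_cat A A B f (Ident out_digraph_cat A) = f"
    using f' by (auto simp: out_digraph_cat_def compose_def extensional_def)
  show "Comp out_digraph_cat A B B (Ident out_digraph_cat B) f = f"
    using f' by (simp add: out_digraph_cat_def Id_compose)
  assume g: "g \<in> Hom out_digraph_cat B C"
  have "nbhd_ordinal_injection A C (compose (verts A) g f) \<longleftrightarrow> nbhd_ordinal_injection A C (g \<circ> f)"
    by (rule nbhd_ordinal_injection_cong[OF A']) (simp add: compose_eq)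
  then show "Comp out_digraph_cat A B C g f \<in> Hom out_digraph_cat A C"
    using g nbhd_ordinal_injection_comp[OF A' B' f'(3), of C g] by (simp add: out_digraph_cat_def)
  show "Comp out_digraph_cat A C D h (Comp out_digraph_cat A B C g f)
      = Comp out_digraph_cat A B D (Comp out_digraph_cat B C D h g) f"
    using compose_assoc[OF f'(2)] by (simp add: out_digraph_cat_def)
qed

lemma category_partitioned_set_cat:
  "category (partitioned_set_cat :: ('u partitioned_set, 'u \<Rightarrow> 'u) cat_data)"
proof
  fix A B C D :: "'u partitioned_set" and f g h :: "'u \<Rightarrow> 'u"
  obtain S r S' r' S'' r'' where ABC: "A = (S, r)" "B = (S', r')" "C = (S'', r'')"
    by (metis surj_pair)
  assume "A \<in> Obj partitioned_set_cat"
  \<comment> \<open>Related elements lie in the carrier, where the restricted identity and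
    \<open>compose\<close> take their intended values.\<close>
  then have r: "r \<subseteq> S \<times> S"
    by (auto simp: ABC partitioned_set_cat_def equiv_def refl_on_def)
  then show "Ident partitioned_set_cat A \<in> Hom partitioned_set_cat A A"
    by (auto simp: ABC partitioned_set_cat_def)
  assume "f \<in> Hom partitioned_set_cat A B"
  then have f: "f \<in> extensional S" "f \<in> S \<rightarrow> S'" "\<And>x y. (x, y) \<in> r \<Longrightarrow> (f x, f y) \<in> r'"
    by (auto simp: ABC partitioned_set_cat_def PiE_def)
  show "Comp partitioned_set_cat A A B f (Ident partitioned_set_cat A) = f"
    using f by (auto simp: ABC partitioned_set_cat_def compose_def extensional_def)
  show "Comp partitioned_set_cat A B B (Ident partitioned_set_cat B) f = f"
    using f by (simp add: ABC partitioned_set_cat_def Id_compose)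
  assume "g \<in> Hom partitioned_set_cat B C"
  then have g: "g \<in> S' \<rightarrow> S''" "\<And>x y. (x, y) \<in> r' \<Longrightarrow> (g x, g y) \<in> r''"
    by (auto simp: ABC partitioned_set_cat_def)
  have "compose S g f \<in> S \<rightarrow>\<^sub>E S''"
    using f(2) g(1) by (auto simp: compose_def)
  moreover have "(compose S g f x, compose S g f y) \<in> r''" if "(x, y) \<in> r" for x y
    using that r f(3) g(2) by (auto simp: compose_eq)
  ultimately show "Comp partitioned_set_cat A B C g f \<in> Hom partitioned_set_cat A C"
    by (auto simp: ABC partitioned_set_cat_def)
  show "Comp partitioned_set_cat A C D h (Comp partitioned_set_cat A B C g f)
      = Comp partitioned_set_cat A B D (Comp partitioned_set_cat B C D h g) f"
    using compose_assoc[OF f(2)] by (simp add: ABC partitioned_set_cat_def)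
qed

theorem theorem5p31:
  fixes t :: ennreal
  shows "cat_functor (out_digraph_cat :: ('u out_digraph, 'u \<Rightarrow> 'u) cat_data)
           (partitioned_set_cat :: ('u partitioned_set, 'u \<Rightarrow> 'u) cat_data)
           (rank_linkage t) (\<lambda>G H \<iota>. \<iota>) \<and>
         (\<forall>(G :: 'a out_digraph) (G' :: 'b out_digraph) \<iota> x y.
           out_ordered_digraph G \<longrightarrow> out_ordered_digraph G' \<longrightarrow>
           nbhd_ordinal_injection G G' \<iota> \<longrightarrow>
           x \<in> verts G \<longrightarrow> y \<in> verts G \<longrightarrow>
           (x, y) \<in> linkage_rel t G \<longrightarrow> (\<iota> x, \<iota> y) \<in> linkage_rel t G')"
proof
  interpret source: category "out_digraph_cat :: ('u out_digraph, 'u \<Rightarrow> 'u) cat_data"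
    by (rule category_out_digraph_cat)
  interpret target: category "partitioned_set_cat :: ('u partitioned_set, 'u \<Rightarrow> 'u) cat_data"
    by (rule category_partitioned_set_cat)
  show "cat_functor (out_digraph_cat :: ('u out_digraph, 'u \<Rightarrow> 'u) cat_data)
     (partitioned_set_cat :: ('u partitioned_set, 'u \<Rightarrow> 'u) cat_data) (rank_linkage t) (\<lambda>G H \<iota>. \<iota>)"
  proof
    fix A B C :: "'u out_digraph" and f g :: "'u \<Rightarrow> 'u"
    show "rank_linkage t A \<in> Obj partitioned_set_cat"
      by (simp add: partitioned_set_cat_def rank_linkage_def equiv_linkage_rel)
    \<comment> \<open>Linkage keeps the carrier, and identities and composites in both categories
      depend on carriers and maps alone.\<close>
    show "Ident out_digraph_cat A = Ident partitioned_set_cat (rank_linkage t A)"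
      by (simp add: out_digraph_cat_def partitioned_set_cat_def rank_linkage_def)
    show "Comp out_digraph_cat A B C g f
      = Comp partitioned_set_cat (rank_linkage t A) (rank_linkage t B) (rank_linkage t C) g f"
      by (simp add: out_digraph_cat_def partitioned_set_cat_def rank_linkage_def)
    assume "A \<in> Obj out_digraph_cat" "f \<in> Hom out_digraph_cat A B"
    then have "out_ordered_digraph A" "nbhd_ordinal_injection A B f" "f \<in> extensional (verts A)"
      by (auto simp: out_digraph_cat_def)
    then show "f \<in> Hom partitioned_set_cat (rank_linkage t A) (rank_linkage t B)"
      using linkage_rel_injection injection_in_verts
      by (auto simp: partitioned_set_cat_def rank_linkage_def PiE_def)
  qed
\<comment> \<open>The second claim allows different vertex types, so it follows from the lemma on
  injections rather than from the functor.\<close>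
qed (blast intro: linkage_rel_injection)

end
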